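(* Let $A$ and $A'$ be $n$-qubit systems and let $\mathrm{id}$ be the identity channel from $A$ to $A'$. Then $$\gamma_{\mathrm{MPC}^\star(A\to A')}(\mathrm{id})=4^n .$$
   Context: $\mathrm{HP}(A\to A')$ is the real vector space of Hermitian-preserving linear maps from operators on $\mathcal H_A$ to operators on $\mathcal H_{A'}$. Quasiprobability extent: for $S\subset \mathrm{HP}(A\to A')$ and $\mathcal{E}\in\mathrm{HP}(A\to A')$, $\gamma_S(\mathcal{E})=\inf\{\sum_{i=1}^m|a_i| : m\ge 1,\ \mathcal{E}=\sum_{i=1}^m a_i\mathcal{F}_i,\ \mathcal{F}_i\in S,\ a_i\in\mathbb{R}\}$ ($=\infty$ if no decomposition exists). $\mathrm{MPC}^\star(A\to A')$ (measure-and-prepare without classical communication, with weighting by classical side information) is the set of all maps $$\rho\mapsto\sum_{i,j}\beta_{i,j}\,\mathrm{tr}[M_i\rho]\,p_j\,\sigma_j$$ where $\beta_{i,j}\in[-1,1]$, $(M_i)_i$ is a (countable) POVM on $A$ (i.e. $M_i\ge 0$, $\sum_iM_i=\mathbb{1}$), $(p_j)_j$ is a probability vector, and the $\sigma_j$ are density operators on $A'$. *)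

theory Defs
  imports "HOL-Analysis.Analysis"
begin

text \<open>
  A finite-dimensional system is represented by a finite index type \<open>'a\<close> labelling an
  orthonormal basis of its Hilbert space, so operators on it are square complex matrices over
  \<open>'a\<close>.  An \<open>n\<close>-qubit system is one with \<open>CARD('a) = 2 ^ n\<close>.
\<close>

type_synonym 'a op = "complex^'a^'a"
type_synonym ('a, 'b) opmap = "'a op \<Rightarrow> 'b op"

definition cscale :: "complex \<Rightarrow> 'a::finite op \<Rightarrow> 'a op" where
  "cscale c X = map_matrix ((*) c) X"

definition adjoint_op :: "'a::finite op \<Rightarrow> 'a op" where
  "adjoint_op X = transpose (map_matrix cnj X)"

definition hermitian :: "'a::finite op \<Rightarrow> bool" where
  "hermitian X \<longleftrightarrow> adjoint_op X = X"

definition pos_semidef :: "'a::finite op \<Rightarrow> bool" where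
  "pos_semidef X \<longleftrightarrow>
     hermitian X \<and> (\<forall>v :: complex^'a. 0 \<le> Re (\<Sum>k\<in>UNIV. cnj (v $ k) * (X *v v) $ k))"

definition density_op :: "'a::finite op \<Rightarrow> bool" where
  "density_op X \<longleftrightarrow> pos_semidef X \<and> trace X = 1"

definition HP :: "('a::finite, 'b::finite) opmap set" where
  "HP = {F. Vector_Spaces.linear cscale cscale F \<and> (\<forall>X. hermitian X \<longrightarrow> hermitian (F X))}"

text \<open>
  The infimum is taken in the extended reals, so it is \<open>\<infinity>\<close> if there is no decomposition.
\<close>

definition qp_extent :: "('a::finite, 'b::finite) opmap set \<Rightarrow> ('a, 'b) opmap \<Rightarrow> ereal" where
  "qp_extent S E =
     Inf {ereal (\<Sum>i<m. \<bar>a i\<bar>) | (m :: nat) (a :: nat \<Rightarrow> real) (F :: nat \<Rightarrow> ('a, 'b) opmap).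
            m \<ge> 1 \<and> (\<forall>i<m. F i \<in> S) \<and> (\<forall>\<rho>. E \<rho> = (\<Sum>i<m. a i *\<^sub>R F i \<rho>))}"

definition povm :: "nat set \<Rightarrow> (nat \<Rightarrow> 'a::finite op) \<Rightarrow> bool" where
  "povm I M \<longleftrightarrow> (\<forall>i\<in>I. pos_semidef (M i)) \<and> (M has_sum mat 1) I"

definition prob_vector :: "nat set \<Rightarrow> (nat \<Rightarrow> real) \<Rightarrow> bool" where
  "prob_vector J p \<longleftrightarrow> (\<forall>j\<in>J. 0 \<le> p j) \<and> (p has_sum 1) J"

text \<open>
  The index sets \<open>I\<close> and \<open>J\<close> are arbitrary sets of natural numbers, so that both finite and
  countably infinite families are covered.
\<close>

definition MPC_star :: "('a::finite, 'b::finite) opmap set" where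
  "MPC_star = {F. \<exists>(I :: nat set) (J :: nat set) \<beta> M p \<sigma>.
     povm I M \<and> prob_vector J p \<and> (\<forall>j\<in>J. density_op (\<sigma> j)) \<and>
     (\<forall>i\<in>I. \<forall>j\<in>J. \<beta> i j \<in> {-1..1 :: real}) \<and>
     (\<forall>\<rho>. ((\<lambda>(i, j). cscale (complex_of_real (\<beta> i j) * trace (M i ** \<rho>) * complex_of_real (p j)) (\<sigma> j))
             has_sum F \<rho>) (I \<times> J))}"

lemma vector_space_cscale: "vector_space (cscale :: complex \<Rightarrow> 'a::finite op \<Rightarrow> 'a op)"
  by unfold_locales (auto simp: cscale_def vec_eq_iff algebra_simps)

lemma HP_I:
  fixes F :: "('a::finite, 'b::finite) opmap"
  assumes "\<And>X Y. F (X + Y) = F X + F Y" "\<And>c X. F (cscale c X) = cscale c (F X)"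
    and "\<And>X. hermitian X \<Longrightarrow> hermitian (F X)"
  shows "F \<in> HP"
  using assms by (simp add: HP_def Vector_Spaces.linear_iff vector_space_cscale)

lemma id_in_HP: "id \<in> HP"
  by (rule HP_I) auto

lemma trace_mult_cscale: "trace (A ** cscale c X) = c * trace (A ** X)"
  by (simp add: trace_def matrix_matrix_mult_def cscale_def sum_distrib_left ac_simps)

lemma bounded_linear_entry: "bounded_linear (\<lambda>X :: 'a::finite op. X $ k $ l)"
  using bounded_linear_compose[OF bounded_linear_vec_nth bounded_linear_vec_nth] .

lemma has_sum_entry:
  assumes "(f has_sum X) A"
  shows "((\<lambda>x. (f x :: 'a::finite op) $ k $ l) has_sum (X $ k $ l)) A"
  using has_sum_bounded_linear[OF bounded_linear_entry assms] by (simp add: o_def)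

lemma hermitian_entry: "hermitian X \<longleftrightarrow> (\<forall>k l. cnj (X $ l $ k) = X $ k $ l)"
  by (simp add: hermitian_def adjoint_op_def transpose_def vec_eq_iff)

lemma trace_hermitian_mult:
  assumes "hermitian A" "hermitian B"
  shows "cnj (trace (A ** B)) = trace (A ** B)"
proof -
  have "cnj (trace (A ** B)) = (\<Sum>k\<in>UNIV. \<Sum>l\<in>UNIV. A $ l $ k * B $ k $ l)"
    using assms by (simp add: trace_def matrix_matrix_mult_def hermitian_entry)
  also have "\<dots> = trace (A ** B)"
    by (subst sum.swap) (simp add: trace_def matrix_matrix_mult_def)
  finally show ?thesis .
qed

lemma MPC_star_subset_HP: "MPC_star \<subseteq> HP"
proof
  fix F :: "('a, 'b) opmap" assume "F \<in> MPC_star"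
  then obtain I J :: "nat set" and \<beta> :: "nat \<Rightarrow> nat \<Rightarrow> real" and M p \<sigma> where
    M: "povm I M" and s: "\<forall>j\<in>J. density_op (\<sigma> j)" and
    F: "\<And>\<rho>. ((\<lambda>(i, j). cscale (complex_of_real (\<beta> i j) * trace (M i ** \<rho>) * complex_of_real (p j)) (\<sigma> j))
             has_sum F \<rho>) (I \<times> J)"
    unfolding MPC_star_def by blast
  have E: "((\<lambda>(i, j). complex_of_real (\<beta> i j) * trace (M i ** \<rho>) * complex_of_real (p j) * \<sigma> j $ k $ l)
             has_sum F \<rho> $ k $ l) (I \<times> J)" for \<rho> k l
    using has_sum_entry[OF F, of \<rho> k l] by (simp add: cscale_def case_prod_unfold)
  have add: "F (X + Y) = F X + F Y" for X Y
  proof -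
    have "F (X + Y) $ k $ l = F X $ k $ l + F Y $ k $ l" for k l
      using has_sum_unique[OF E has_sum_add[OF E E, THEN has_sum_cong[THEN iffD1, rotated]]]
      by (auto simp: matrix_add_ldistrib trace_add algebra_simps)
    then show ?thesis by (simp add: vec_eq_iff)
  qed
  have scale: "F (cscale c X) = cscale c (F X)" for c X
  proof -
    have "F (cscale c X) $ k $ l = c * F X $ k $ l" for k l
      using has_sum_unique[OF E has_sum_cmult_right[OF E, THEN has_sum_cong[THEN iffD1, rotated]]]
      by (auto simp: trace_mult_cscale algebra_simps)
    then show ?thesis by (simp add: vec_eq_iff cscale_def)
  qed
  have herm: "hermitian (F X)" if X: "hermitian X" for X
  proof -
    have "cnj (F X $ l $ k) = F X $ k $ l" for k l
    proof (rule has_sum_unique[OF _ E])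
      have "((\<lambda>x. cnj (case x of (i, j) \<Rightarrow> complex_of_real (\<beta> i j) * trace (M i ** X) *
                complex_of_real (p j) * \<sigma> j $ l $ k)) has_sum cnj (F X $ l $ k)) (I \<times> J)"
        using E by (simp only: has_sum_cnj_iff)
      then show "((\<lambda>(i, j). complex_of_real (\<beta> i j) * trace (M i ** X) * complex_of_real (p j) *
                \<sigma> j $ k $ l) has_sum cnj (F X $ l $ k)) (I \<times> J)"
      proof (rule has_sum_cong[THEN iffD1, rotated], clarify)
        fix i j assume "i \<in> I" "j \<in> J"
        then have "hermitian (M i)" "hermitian (\<sigma> j)"
          using M s by (auto simp: povm_def density_op_def pos_semidef_def)
        then show "cnj (complex_of_real (\<beta> i j) * trace (M i ** X) * complex_of_real (p j) * \<sigma> j $ l $ k)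
            = complex_of_real (\<beta> i j) * trace (M i ** X) * complex_of_real (p j) * \<sigma> j $ k $ l"
          using trace_hermitian_mult[OF _ X] by (simp add: hermitian_entry)
      qed
    qed
    then show ?thesis by (simp add: hermitian_entry)
  qed
  show "F \<in> HP"
    using add scale herm by (rule HP_I)
qed

end

theory Submission
  imports Defs
begin

text \<open>
  Lower bound: the trace of a map, viewed as an operator on the matrix space, is linear, has modulus
  at most 1 on \<^const>\<open>MPC_star\<close>, and equals \<open>d\<^sup>2\<close> on the identity of a
  \<open>d\<close>-dimensional system.  Upper bound: in the expansion
  \<open>\<rho> = \<Sum>\<^sub>P tr (P \<rho>) P / d\<close> over the \<open>d\<^sup>2\<close> Pauli operators every
  summand is a map in \<^const>\<open>MPC_star\<close>, used with coefficient 1.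
\<close>

section \<open>Sesquilinear forms, Schur complements and positivity of trace products\<close>

definition sform :: "'a::finite op \<Rightarrow> complex^'a \<Rightarrow> complex^'a \<Rightarrow> complex" where
  "sform A u v = (\<Sum>k\<in>UNIV. \<Sum>l\<in>UNIV. cnj (u $ k) * A $ k $ l * v $ l)"

lemma pos_semidef_sform:
  "pos_semidef A \<longleftrightarrow> hermitian A \<and> (\<forall>v. 0 \<le> Re (sform A v v))"
  by (simp add: pos_semidef_def sform_def matrix_vector_mult_def sum_distrib_left mult.assoc)

lemma sform_diff_left: "sform A (u - w) v = sform A u v - sform A w v"
  and sform_diff_right: "sform A u (v - w) = sform A u v - sform A u w"
  by (simp_all add: sform_def algebra_simps sum_subtractf)

lemma sform_scale_left: "sform A (c *s u) v = cnj c * sform A u v"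
  and sform_scale_right: "sform A u (c *s v) = c * sform A u v"
  by (simp_all add: sform_def algebra_simps sum_distrib_left)

lemma sform_axis_left: "sform A (axis k 1) v = (\<Sum>l\<in>UNIV. A $ k $ l * v $ l)"
proof -
  have "(\<Sum>l\<in>UNIV. cnj (axis k 1 $ j) * A $ j $ l * v $ l) =
      (if j = k then \<Sum>l\<in>UNIV. A $ k $ l * v $ l else 0)" for j
    by (simp add: axis_def)
  then show ?thesis by (simp add: sform_def)
qed

lemma sform_axis_axis: "sform A (axis k 1) (axis l 1) = A $ k $ l"
proof -
  have "A $ k $ j * axis l 1 $ j = (if j = l then A $ k $ l else 0)" for j
    by (simp add: axis_def)
  then show ?thesis by (simp add: sform_axis_left)
qed

lemma sform_cnj_swap:
  assumes "hermitian A"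
  shows "cnj (sform A u v) = sform A v u"
proof -
  have "cnj (sform A u v) = (\<Sum>k\<in>UNIV. \<Sum>l\<in>UNIV. cnj (v $ l) * A $ l $ k * u $ k)"
    using assms by (simp add: sform_def hermitian_entry ac_simps)
  also have "\<dots> = sform A v u"
    by (subst sum.swap) (simp add: sform_def)
  finally show ?thesis .
qed

text \<open>Sesquilinear expansion, where hermiticity makes the two cross terms conjugate. It serves
  two choices of \<open>c\<close>: one making the form negative, one completing the square.\<close>

lemma sform_shift:
  assumes "hermitian A"
  shows "Re (sform A (v - c *s axis k 1) (v - c *s axis k 1)) =
    Re (sform A v v) - 2 * Re (cnj c * sform A (axis k 1) v) + (cmod c)\<^sup>2 * Re (A $ k $ k)"
proof -
  have 1: "sform A v (axis k 1) = cnj (sform A (axis k 1) v)"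
    using sform_cnj_swap[OF assms] by simp
  have 2: "Re (c * cnj c * z) = (cmod c)\<^sup>2 * Re z" for z
    by (simp add: complex_norm_square[symmetric] del: of_real_power)
  have "Re (sform A (v - c *s axis k 1) (v - c *s axis k 1)) =
    Re (sform A v v) - Re (c * cnj (sform A (axis k 1) v)) - Re (cnj c * sform A (axis k 1) v)
    + Re (c * cnj c * (A $ k $ k))"
    by (simp only: sform_diff_left sform_diff_right sform_scale_left sform_scale_right 1
        sform_axis_axis) (simp add: algebra_simps)
  then show ?thesis unfolding 2 by simp
qed

lemma pos_semidef_diag:
  assumes "pos_semidef A"
  shows "0 \<le> Re (A $ k $ k)" and "A $ k $ k = of_real (Re (A $ k $ k))"
proof -
  have "0 \<le> Re (sform A (axis k 1) (axis k 1))"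
    using assms by (simp only: pos_semidef_sform)
  then show "0 \<le> Re (A $ k $ k)" by (simp add: sform_axis_axis)
  have "cnj (A $ k $ k) = A $ k $ k"
    using assms by (simp add: pos_semidef_sform hermitian_entry)
  then show "A $ k $ k = of_real (Re (A $ k $ k))"
    by (simp add: complex_eq_iff)
qed

text \<open>With a zero diagonal entry the quadratic term of \<open>sform_shift\<close> disappears,
  so a nonzero \<open>A $ k $ l\<close> would make the form unbounded below along
  \<open>axis k 1\<close>.\<close>

lemma pos_semidef_zero_row:
  assumes A: "pos_semidef A" and 0: "A $ k $ k = 0"
  shows "A $ k $ l = 0"
proof (rule ccontr)
  assume "A $ k $ l \<noteq> 0"
  then have p: "(cmod (A $ k $ l))\<^sup>2 > 0" by simp
  have h: "hermitian A" using A by (simp add: pos_semidef_sform)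
  \<comment> \<open>Chosen so that the shifted form takes the value -1.\<close>
  define r where "r = (Re (A $ l $ l) + 1) / (2 * (cmod (A $ k $ l))\<^sup>2)"
  define c where "c = of_real r * A $ k $ l"
  have "0 \<le> Re (sform A (axis l 1 - c *s axis k 1) (axis l 1 - c *s axis k 1))"
    using A by (simp only: pos_semidef_sform)
  also have "\<dots> = Re (A $ l $ l) - 2 * Re (cnj c * A $ k $ l)"
    by (simp only: sform_shift[OF h] sform_axis_axis 0) simp
  also have "Re (cnj c * A $ k $ l) = r * (cmod (A $ k $ l))\<^sup>2"
    unfolding cmod_power2 by (simp add: c_def power2_eq_square algebra_simps)
  also have "Re (A $ l $ l) - 2 * (r * (cmod (A $ k $ l))\<^sup>2) = -1"
    using p by (simp add: r_def field_simps)
  finally show False by simp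
qed

text \<open>The index type is kept: for \<open>A $ k $ k \<noteq> 0\<close>, row and column
  \<open>k\<close> become zero instead of being deleted.\<close>

definition schur_complement :: "'a::finite \<Rightarrow> 'a op \<Rightarrow> 'a op" where
  "schur_complement k A = (\<chi> l m. A $ l $ m - A $ l $ k * A $ k $ m / A $ k $ k)"

text \<open>Completing the square: the form of the complement at \<open>v\<close> is the minimum of
  the form of \<open>A\<close> over shifts of \<open>v\<close> along
  \<open>axis k 1\<close>.\<close>

lemma pos_semidef_schur_complement:
  assumes A: "pos_semidef A" and nz: "A $ k $ k \<noteq> 0"
  shows "pos_semidef (schur_complement k A)"
proof -
  have h: "hermitian A" and c: "\<And>i j. cnj (A $ i $ j) = A $ j $ i"
    using A by (auto simp: pos_semidef_sform hermitian_entry)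
  define a where "a = Re (A $ k $ k)"
  have a: "A $ k $ k = of_real a" "a > 0"
    using pos_semidef_diag[OF A, of k] nz unfolding a_def by (metis, metis less_eq_real_def of_real_0)
  have "hermitian (schur_complement k A)"
    by (simp add: hermitian_entry schur_complement_def c mult.commute)
  moreover have "0 \<le> Re (sform (schur_complement k A) v v)" for v
  proof -
    define s where "s = sform A (axis k 1) v"
    have cs: "cnj s = (\<Sum>l\<in>UNIV. cnj (v $ l) * A $ l $ k)"
      by (simp add: s_def sform_axis_left c mult.commute)
    have "cnj s * s / A $ k $ k =
        (\<Sum>l\<in>UNIV. \<Sum>m\<in>UNIV. cnj (v $ l) * (A $ l $ k * A $ k $ m / A $ k $ k) * v $ m)"
      unfolding cs unfolding s_def sform_axis_left sum_product sum_divide_distrib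
      by (simp add: ac_simps)
    then have "sform (schur_complement k A) v v = sform A v v - cnj s * s / A $ k $ k"
      by (simp add: sform_def schur_complement_def right_diff_distrib left_diff_distrib sum_subtractf)
    also have "Re \<dots> = Re (sform A v v) - (cmod s)\<^sup>2 / a"
      unfolding cmod_power2 by (simp add: a power2_eq_square)
    \<comment> \<open>At the minimiser \<open>c = s / a\<close> the last two terms of
      \<open>sform_shift\<close> become \<open>-2 |s|^2 / a + |s|^2 / a\<close>.\<close>
    also have "\<dots> = Re (sform A (v - (s / a) *s axis k 1) (v - (s / a) *s axis k 1))"
    proof -
      have "Re (cnj (s / a) * s) = (cmod s)\<^sup>2 / a"
        unfolding cmod_power2 by (simp add: power2_eq_square)
      then show ?thesis
        using a unfolding sform_shift[OF h] s_def[symmetric]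
        by (simp add: norm_divide power2_eq_square)
    qed
    also have "\<dots> \<ge> 0" using A by (simp only: pos_semidef_sform)
    finally show ?thesis .
  qed
  ultimately show ?thesis by (simp add: pos_semidef_sform)
qed

text \<open>Induction on the set of nonzero rows: each step splits off a rank-one positive part, as in
  the Cholesky decomposition.\<close>

lemma trace_mult_pos_semidef_nonneg:
  assumes "pos_semidef A" "pos_semidef B"
  shows "0 \<le> Re (trace (A ** B))"
proof -
  have "0 \<le> Re (trace (A ** B))"
    if "finite S" "pos_semidef A" "\<And>l m. l \<notin> S \<Longrightarrow> A $ l $ m = 0" for S A
    using that
  proof (induction S arbitrary: A rule: finite_induct)
    case empty
    then show ?case by (simp add: trace_def matrix_matrix_mult_def)
  next
    case (insert k S)
    show ?case
    proof (cases "A $ k $ k = 0")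
      case True
      \<comment> \<open>Row \<open>k\<close> vanishes as well, so the nonzero rows already lie in
        \<open>S\<close>.\<close>
      then have "A $ l $ m = 0" if "l \<notin> S" for l m
        using insert.prems pos_semidef_zero_row[OF insert.prems(1) True] that by (cases "l = k") auto
      then show ?thesis using insert by blast
    next
      case False
      have c: "cnj (A $ i $ j) = A $ j $ i" for i j
        using insert.prems by (auto simp: pos_semidef_sform hermitian_entry)
      define a where "a = Re (A $ k $ k)"
      have a: "A $ k $ k = of_real a" "a > 0"
        using pos_semidef_diag[OF insert.prems(1), of k] False unfolding a_def
        by (metis, metis less_eq_real_def of_real_0)
      define u where "u = (\<chi> l. A $ l $ k)"
      have "schur_complement k A $ l $ m = 0" if "l \<notin> S" for l m
        using that insert.prems(2)[of l] False by (cases "l = k") (auto simp: schur_complement_def)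
      then have IH: "0 \<le> Re (trace (schur_complement k A ** B))"
        using insert.IH pos_semidef_schur_complement[OF insert.prems(1) False] by blast
      \<comment> \<open>\<open>A\<close> is its Schur complement plus the rank-one matrix
        \<open>u u^* / a\<close>; the latter contributes \<open>u^* B u / a\<close>.\<close>
      have "trace (A ** B) = trace (schur_complement k A ** B) +
          (\<Sum>l\<in>UNIV. \<Sum>m\<in>UNIV. A $ l $ k * A $ k $ m / A $ k $ k * B $ m $ l)"
        by (simp add: trace_def matrix_matrix_mult_def schur_complement_def algebra_simps
            sum_subtractf)
      also have "(\<Sum>l\<in>UNIV. \<Sum>m\<in>UNIV. A $ l $ k * A $ k $ m / A $ k $ k * B $ m $ l) =
          sform B u u / a"
        by (subst sum.swap)
          (simp add: sform_def u_def c a sum_divide_distrib mult.commute mult.left_commute)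
      finally have "Re (trace (A ** B)) = Re (trace (schur_complement k A ** B)) + Re (sform B u u) / a"
        by simp
      then show ?thesis using IH a assms(2) by (simp add: pos_semidef_sform)
    qed
  qed
  from this[of UNIV A] show ?thesis using assms by simp
qed

section \<open>Lower bound via the trace of a map\<close>

definition map_trace :: "('a::finite, 'a) opmap \<Rightarrow> complex" where
  "map_trace F = (\<Sum>k\<in>UNIV. \<Sum>l\<in>UNIV. F (axis k (axis l 1)) $ k $ l)"

text \<open>Evaluates the measurement functional on matrix units. Summed over all units, this turns
  the map trace of \<open>\<rho> \<mapsto> tr (M \<rho>) \<sigma>\<close> into
  \<open>tr (M \<sigma>)\<close>.\<close>

lemma trace_mult_axis: "trace (A ** axis k (axis l 1)) = A $ l $ k"
proof -
  have "A $ i $ j * axis k (axis l 1) $ j $ i = (if j = k then if i = l then A $ l $ k else 0 else 0)" for i j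
    by (auto simp: axis_def)
  then show ?thesis by (simp add: trace_def matrix_matrix_mult_def)
qed

lemma bounded_linear_trace_mult: "bounded_linear (\<lambda>X :: 'a::finite op. trace (X ** B))"
  unfolding trace_def matrix_matrix_mult_def
  by (simp, intro bounded_linear_sum bounded_linear_mult_const[OF bounded_linear_entry])

lemma has_sum_sum:
  fixes f :: "'b \<Rightarrow> 'c \<Rightarrow> 'a::topological_comm_monoid_add"
  assumes "\<And>b. b \<in> B \<Longrightarrow> (f b has_sum s b) A"
  shows "((\<lambda>x. \<Sum>b\<in>B. f b x) has_sum (\<Sum>b\<in>B. s b)) A"
  using assms by (induction B rule: infinite_finite_induct) (simp_all add: has_sum_add)

text \<open>The map trace is the sum of \<open>\<beta> i j * p j * t i j\<close> with
  \<open>t i j = tr (M i \<sigma> j)\<close>. The weights \<open>p j * t i j\<close> form a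
  probability distribution on \<open>I \<times> J\<close>, and every \<open>\<beta> i j\<close> has
  modulus at most 1.\<close>

lemma norm_map_trace_MPC_star:
  assumes "F \<in> MPC_star"
  shows "cmod (map_trace F) \<le> 1"
proof -
  obtain I J :: "nat set" and \<beta> :: "nat \<Rightarrow> nat \<Rightarrow> real" and M p \<sigma> where
    M: "povm I M" and p: "prob_vector J p" and s: "\<forall>j\<in>J. density_op (\<sigma> j)" and
    \<beta>: "\<forall>i\<in>I. \<forall>j\<in>J. \<beta> i j \<in> {-1..1}" and
    F: "\<And>\<rho>. ((\<lambda>(i, j). cscale (complex_of_real (\<beta> i j) * trace (M i ** \<rho>) * complex_of_real (p j)) (\<sigma> j))
             has_sum F \<rho>) (I \<times> J)"
    using assms unfolding MPC_star_def by blast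
  define t where "t i j = Re (trace (M i ** \<sigma> j))" for i j
  have t: "0 \<le> t i j" "trace (M i ** \<sigma> j) = of_real (t i j)" if "i \<in> I" "j \<in> J" for i j
  proof -
    have ps: "pos_semidef (M i)" "pos_semidef (\<sigma> j)"
      using M s that by (auto simp: povm_def density_op_def)
    then show "0 \<le> t i j" unfolding t_def by (rule trace_mult_pos_semidef_nonneg)
    show "trace (M i ** \<sigma> j) = of_real (t i j)"
      using ps trace_hermitian_mult[of "M i" "\<sigma> j"]
      by (simp add: t_def pos_semidef_def complex_eq_iff)
  qed
  \<comment> \<open>Completeness of the POVM and \<open>trace (\<sigma> j) = 1\<close>; continuity
    of the trace covers infinite \<open>I\<close>.\<close>
  have sum_t: "((\<lambda>i. t i j) has_sum 1) I" if "j \<in> J" for j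
  proof -
    have "((\<lambda>i. trace (M i ** \<sigma> j)) has_sum trace (mat 1 ** \<sigma> j)) I"
      using M has_sum_bounded_linear[OF bounded_linear_trace_mult] by (fastforce simp: povm_def o_def)
    then have "((\<lambda>i. Re (trace (M i ** \<sigma> j))) has_sum Re (trace (mat 1 ** \<sigma> j))) I"
      by (rule has_sum_Re)
    then show ?thesis using s that by (simp add: t_def density_op_def)
  qed
  have "((\<lambda>x. \<Sum>k\<in>UNIV. \<Sum>l\<in>UNIV. (case x of (i, j) \<Rightarrow>
      cscale (complex_of_real (\<beta> i j) * trace (M i ** axis k (axis l 1)) * complex_of_real (p j)) (\<sigma> j))
      $ k $ l) has_sum map_trace F) (I \<times> J)"
    unfolding map_trace_def by (intro has_sum_sum has_sum_entry F)
  then have T: "((\<lambda>(i, j). of_real (\<beta> i j * p j * t i j)) has_sum map_trace F) (I \<times> J)"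
  proof (rule has_sum_cong[THEN iffD1, rotated], clarify)
    fix i j assume ij: "i \<in> I" "j \<in> J"
    have "(\<Sum>k\<in>UNIV. \<Sum>l\<in>UNIV. cscale (\<beta> i j * trace (M i ** axis k (axis l 1)) * p j) (\<sigma> j) $ k $ l) =
      \<beta> i j * p j * (\<Sum>k\<in>UNIV. \<Sum>l\<in>UNIV. M i $ l $ k * \<sigma> j $ k $ l)"
      by (simp add: cscale_def trace_mult_axis sum_distrib_left ac_simps)
    also have "\<dots> = \<beta> i j * p j * trace (M i ** \<sigma> j)"
      by (subst sum.swap) (simp add: trace_def matrix_matrix_mult_def)
    finally show "(\<Sum>k\<in>UNIV. \<Sum>l\<in>UNIV. cscale (\<beta> i j * trace (M i ** axis k (axis l 1)) * p j) (\<sigma> j) $ k $ l) =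
       of_real (\<beta> i j * p j * t i j)"
      using ij t by simp
  qed
  \<comment> \<open>It suffices to bound all finite partial sums, since \<open>T\<close> expresses
    the map trace as their limit.\<close>
  have "cmod (\<Sum>(i, j)\<in>G. of_real (\<beta> i j * p j * t i j)) \<le> 1" if G: "finite G" "G \<subseteq> I \<times> J" for G
  proof -
    have p0: "0 \<le> p j" if "j \<in> J" for j using p that by (simp add: prob_vector_def)
    \<comment> \<open>Enlarging \<open>G\<close> to the rectangle of its projections lets the sum
      over \<open>i\<close> be bounded by 1 for each \<open>j\<close> separately.\<close>
    have AB: "finite (fst ` G)" "finite (snd ` G)" "fst ` G \<subseteq> I" "snd ` G \<subseteq> J"
      "G \<subseteq> fst ` G \<times> snd ` G"
      using G by force+
    have "cmod (\<Sum>(i, j)\<in>G. of_real (\<beta> i j * p j * t i j)) \<le> (\<Sum>(i, j)\<in>G. p j * t i j)"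
    proof (rule sum_norm_le, clarify)
      fix i j assume "(i, j) \<in> G"
      then have "i \<in> I" "j \<in> J" using G by auto
      then show "cmod (of_real (\<beta> i j * p j * t i j)) \<le> p j * t i j"
        using mult_right_mono[of "\<bar>\<beta> i j\<bar>" 1 "p j * t i j"] \<beta> t p0
        unfolding norm_of_real by (auto simp: abs_mult abs_le_iff mult.assoc)
    qed
    also have "\<dots> \<le> (\<Sum>(i, j)\<in>fst ` G \<times> snd ` G. p j * t i j)"
      using AB t p0 by (intro sum_mono2) (auto simp: subset_iff)
    also have "\<dots> = (\<Sum>j\<in>snd ` G. p j * (\<Sum>i\<in>fst ` G. t i j))"
      by (subst sum.cartesian_product[symmetric], subst sum.swap) (simp add: sum_distrib_left)
    also have "\<dots> \<le> (\<Sum>j\<in>snd ` G. p j * 1)"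
      using AB p0 t by (intro sum_mono mult_left_mono finite_sum_le_has_sum[OF sum_t]) auto
    also have "\<dots> \<le> 1"
      using AB p0 p by (simp, intro finite_sum_le_has_sum[where A = J]) (auto simp: prob_vector_def)
    finally show ?thesis .
  qed
  then have "\<forall>\<^sub>F G in finite_subsets_at_top (I \<times> J).
      cmod (\<Sum>(i, j)\<in>G. of_real (\<beta> i j * p j * t i j)) \<le> 1"
    by (rule eventually_finite_subsets_at_top_weakI)
  then show ?thesis
    using tendsto_upperbound[OF tendsto_norm[OF T[unfolded has_sum_def]]]
      finite_subsets_at_top_neq_bot by blast
qed

lemma map_trace_id: "map_trace (id :: ('a::finite, 'a) opmap) = of_nat (CARD('a) ^ 2)"
  by (simp add: map_trace_def axis_def power2_eq_square)

text \<open>Taking map traces in a decomposition writes \<open>d^2\<close> as a combination of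
  numbers of modulus at most 1; the triangle inequality finishes.\<close>

lemma qp_extent_id_ge: "ereal (real (CARD('a) ^ 2)) \<le> qp_extent MPC_star (id :: ('a::finite, 'a) opmap)"
  unfolding qp_extent_def
proof (rule Inf_greatest, clarify)
  fix m a and F :: "nat \<Rightarrow> ('a, 'a) opmap"
  assume F: "\<forall>i<m. F i \<in> MPC_star" and E: "\<forall>\<rho>. id \<rho> = (\<Sum>i<m. a i *\<^sub>R F i \<rho>)"
  have "map_trace (id :: ('a, 'a) opmap) = (\<Sum>i<m. a i *\<^sub>R map_trace (F i))"
  proof -
    have "map_trace (id :: ('a, 'a) opmap) = (\<Sum>k\<in>UNIV. \<Sum>l\<in>UNIV. \<Sum>i<m. a i *\<^sub>R F i (axis k (axis l 1)) $ k $ l)"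
      unfolding map_trace_def by (subst E[rule_format]) (simp add: sum_component)
    also have "\<dots> = (\<Sum>i<m. \<Sum>k\<in>UNIV. \<Sum>l\<in>UNIV. a i *\<^sub>R F i (axis k (axis l 1)) $ k $ l)"
      by (simp only: sum.swap[where A = "{..<m}"])
    finally show ?thesis by (simp add: map_trace_def scaleR_sum_right)
  qed
  then have "real (CARD('a) ^ 2) = cmod (\<Sum>i<m. a i *\<^sub>R map_trace (F i))"
    using norm_of_nat[of "CARD('a) ^ 2", where 'a = complex] by (simp only: map_trace_id)
  also have "\<dots> \<le> (\<Sum>i<m. \<bar>a i\<bar>)"
  proof (rule sum_norm_le)
    fix i assume "i \<in> {..<m}"
    then have "cmod (map_trace (F i)) \<le> 1" using F norm_map_trace_MPC_star by blast
    then show "norm (a i *\<^sub>R map_trace (F i)) \<le> \<bar>a i\<bar>"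
      by (simp add: mult_left_le)
  qed
  finally show "ereal (real (CARD('a) ^ 2)) \<le> ereal (\<Sum>i<m. \<bar>a i\<bar>)" by simp
qed


section \<open>Component maps of Hermitian involutions as measure-and-prepare maps\<close>

lemma pos_semidef_scaleR:
  assumes "pos_semidef A" "0 \<le> r"
  shows "pos_semidef (r *\<^sub>R A)"
proof -
  have "sform (r *\<^sub>R A) v v = r *\<^sub>R sform A v v" for v
    by (simp add: sform_def scaleR_sum_right)
  then show ?thesis
    using assms by (simp add: pos_semidef_sform hermitian_entry)
qed

text \<open>The form at \<open>v\<close> is the squared norm of \<open>Q *v v\<close>, once one
  factor is moved across by hermiticity.\<close>

lemma pos_semidef_square:
  assumes "hermitian Q"
  shows "pos_semidef (Q ** Q)"
proof -
  have c: "cnj (Q $ i $ j) = Q $ j $ i" for i j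
    using assms by (simp add: hermitian_entry)
  have "hermitian (Q ** Q)"
    by (simp add: hermitian_entry matrix_matrix_mult_def c mult.commute)
  moreover have "0 \<le> Re (sform (Q ** Q) v v)" for v
  proof -
    have "sform (Q ** Q) v v =
        (\<Sum>k\<in>UNIV. \<Sum>l\<in>UNIV. \<Sum>j\<in>UNIV. cnj (v $ k) * (Q $ k $ j * Q $ j $ l) * v $ l)"
      by (simp add: sform_def matrix_matrix_mult_def sum_distrib_left sum_distrib_right)
    also have "\<dots> = (\<Sum>j\<in>UNIV. \<Sum>k\<in>UNIV. \<Sum>l\<in>UNIV. cnj (v $ k) * (Q $ k $ j * Q $ j $ l) * v $ l)"
      by (subst sum.swap[of _ UNIV UNIV, symmetric], rule sum.cong[OF refl], rule sum.swap)
    also have "\<dots> = (\<Sum>j\<in>UNIV. cnj (\<Sum>k\<in>UNIV. Q $ j $ k * v $ k) * (\<Sum>l\<in>UNIV. Q $ j $ l * v $ l))"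
      unfolding sum_product cnj_sum by (simp add: c ac_simps)
    also have "\<dots> = (\<Sum>j\<in>UNIV. of_real ((cmod (\<Sum>l\<in>UNIV. Q $ j $ l * v $ l))\<^sup>2))"
      by (simp only: complex_norm_square mult.commute)
    finally show ?thesis
      by (simp add: sum_nonneg)
  qed
  ultimately show ?thesis by (simp add: pos_semidef_sform)
qed

lemma matrix_add_rdistrib: "(A + B) ** C = A ** C + B ** (C :: 'a::finite op)"
  and matrix_diff_rdistrib: "(A - B) ** C = A ** C - B ** (C :: 'a::finite op)"
  by (simp_all add: matrix_matrix_mult_def vec_eq_iff algebra_simps sum.distrib sum_subtractf)

lemma hermitian_mat_1: "hermitian (mat 1)"
  by (simp add: hermitian_entry mat_def)

text \<open>\<open>mat 1 + P\<close> is twice a projection, hence half of its own square.\<close>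

lemma pos_semidef_one_plus_involution:
  assumes "hermitian P" "P ** P = mat 1"
  shows "pos_semidef (mat 1 + P)"
proof -
  have "hermitian (mat 1 + P)"
    using assms(1) hermitian_mat_1 by (simp add: hermitian_entry)
  then have "pos_semidef ((1/2) *\<^sub>R ((mat 1 + P) ** (mat 1 + P)))"
    by (intro pos_semidef_scaleR pos_semidef_square) auto
  also have "(mat 1 + P) ** (mat 1 + P) = 2 *\<^sub>R (mat 1 + P)"
    by (simp add: matrix_add_ldistrib matrix_add_rdistrib assms(2) scaleR_2 algebra_simps)
  finally show ?thesis by simp
qed

text \<open>For a Hermitian involution \<open>P\<close> this is the Hilbert-Schmidt orthogonal
  projection onto its span, since \<open>tr (P P)\<close> is the dimension.\<close>

definition component_map :: "'a::finite op \<Rightarrow> ('a, 'a) opmap" where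
  "component_map P \<rho> = cscale (trace (P ** \<rho>) / of_nat CARD('a)) P"

lemma trace_scaleR: "trace (r *\<^sub>R A) = of_real r * trace (A :: 'a::finite op)"
  by (simp add: trace_def sum_distrib_left scaleR_conv_of_real[where 'a = complex])

lemma trace_scaleR_mult: "trace ((r *\<^sub>R A) ** B) = of_real r * trace (A ** B :: 'a::finite op)"
  by (simp add: trace_def matrix_matrix_mult_def sum_distrib_left scaleR_conv_of_real[where 'a = complex] mult.assoc)

text \<open>Discard the input and prepare the maximally mixed state. The identity is treated
  separately because its trace is not 0.\<close>

lemma component_map_one_in_MPC_star: "component_map (mat 1) \<in> MPC_star"
proof -
  have one: "pos_semidef (mat 1 :: 'a op)"
    using pos_semidef_square[OF hermitian_mat_1] by simp
  show ?thesis
    unfolding MPC_star_def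
  proof (rule CollectI, intro exI conjI allI)
    show "povm {0} (\<lambda>_. mat 1 :: 'a op)"
      using one by (simp add: povm_def has_sum_finiteI)
    show "prob_vector {0} (\<lambda>_. 1)"
      by (simp add: prob_vector_def has_sum_finiteI)
    show "\<forall>j\<in>{0}. density_op ((1 / CARD('a)) *\<^sub>R (mat 1 :: 'a op))"
      using one by (simp add: density_op_def pos_semidef_scaleR trace_scaleR trace_I)
    show "\<forall>i\<in>{0}. \<forall>j\<in>{0}. (1::real) \<in> {-1..1}" by simp
    fix \<rho> :: "'a op"
    show "((\<lambda>(i, j). cscale (complex_of_real 1 * trace (mat 1 ** \<rho>) * complex_of_real 1)
        ((1 / CARD('a)) *\<^sub>R (mat 1 :: 'a op))) has_sum component_map (mat 1) \<rho>) ({0} \<times> {0})"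
      by (rule has_sum_finiteI)
        (simp_all add: component_map_def cscale_def vec_eq_iff scaleR_conv_of_real[where 'a = complex])
  qed
qed

text \<open>Both \<open>P\<close> and \<open>\<rho> \<mapsto> tr (P \<rho>)\<close> split into the two spectral projections
  \<open>(1 \<plusminus> P) / 2\<close>; the signs are absorbed by \<open>\<beta>\<close>, and tracelessness makes the
  projections equally large, so that both prepared states have weight \<open>1/2\<close>.\<close>

lemma component_map_involution_in_MPC_star:
  assumes P: "hermitian P" "P ** P = mat 1" "trace P = 0"
  shows "component_map P \<in> MPC_star"
proof -
  \<comment> \<open>Twice the spectral projections of \<open>P\<close>: halved they form the POVM,
    divided by the dimension they are the prepared states.\<close>
  define Q where "Q i = (if i = (0::nat) then mat 1 + P else mat 1 - P)" for i
  have "pos_semidef (mat 1 + (- P))"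
    using P by (intro pos_semidef_one_plus_involution)
      (simp_all add: hermitian_entry matrix_matrix_mult_def vec_eq_iff)
  then have Q: "pos_semidef (Q i)" for i
    using P by (simp add: Q_def pos_semidef_one_plus_involution)
  have trQ: "trace (Q i) = of_nat CARD('a)" for i
    using P by (simp add: Q_def trace_add trace_sub trace_I)
  have tr: "trace (Q i ** \<rho>) = trace \<rho> + (if i = 0 then 1 else -1) * trace (P ** \<rho>)" for i \<rho>
    by (simp add: Q_def matrix_add_rdistrib matrix_diff_rdistrib trace_add trace_sub)
  show ?thesis
    unfolding MPC_star_def
  proof (rule CollectI, intro exI conjI allI)
    show "povm {0, 1} (\<lambda>i. (1/2) *\<^sub>R Q i)"
    proof -
      have "(1/2) *\<^sub>R Q 0 + (1/2) *\<^sub>R Q 1 = mat 1"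
        by (simp add: Q_def flip: scaleR_add_right scaleR_2)
      then show ?thesis
        using Q by (auto simp: povm_def pos_semidef_scaleR intro!: has_sum_finiteI)
    qed
    show "prob_vector {0, 1} (\<lambda>_. 1/2)"
      by (auto simp: prob_vector_def intro!: has_sum_finiteI)
    show "\<forall>j\<in>{0, 1}. density_op ((1 / CARD('a)) *\<^sub>R Q j)"
      using Q by (simp add: density_op_def pos_semidef_scaleR trace_scaleR trQ)
    \<comment> \<open>The weight is the product of the eigenvalues of \<open>P\<close> belonging to
      \<open>i\<close> and \<open>j\<close>.\<close>
    show "\<forall>i\<in>{0, 1}. \<forall>j\<in>{0, 1}. (if i = j then 1 else -1 :: real) \<in> {-1..1}" by simp
    fix \<rho> :: "'a op"
    show "((\<lambda>(i, j). cscale (complex_of_real (if i = j then 1 else -1) *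
        trace (((1/2) *\<^sub>R Q i) ** \<rho>) * complex_of_real (1/2)) ((1 / CARD('a)) *\<^sub>R Q j))
        has_sum component_map P \<rho>) ({0, 1} \<times> {0, 1})"
    proof (rule has_sum_finiteI)
      have half: "trace (((1/2) *\<^sub>R Q i) ** \<rho>) = trace (Q i ** \<rho>) / 2" for i
        by (simp add: trace_scaleR_mult)
      \<comment> \<open>Here \<open>t\<close> and \<open>p\<close> stand for the traces of
        \<open>\<rho>\<close> and \<open>P ** \<rho>\<close>, \<open>e\<close> and \<open>q\<close>
        for entries of \<open>mat 1\<close> and \<open>P\<close>; the signs cancel everything but
        \<open>p * q\<close>.\<close>
      have "p / D * q = (t + p) / 2 * (1/2) * ((e + q) / D) - (t + p) / 2 * (1/2) * ((e - q) / D)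
          - (t - p) / 2 * (1/2) * ((e + q) / D) + (t - p) / 2 * (1/2) * ((e - q) / D)"
        for p q t e D :: complex
        by (simp only: times_divide_eq_left times_divide_eq_right diff_divide_distrib[symmetric]
            add_divide_distrib[symmetric]) (simp add: algebra_simps)
      then have "component_map P \<rho> =
          cscale (trace (((1/2) *\<^sub>R Q 0) ** \<rho>) * (1/2)) ((1 / CARD('a)) *\<^sub>R Q 0)
          - cscale (trace (((1/2) *\<^sub>R Q 0) ** \<rho>) * (1/2)) ((1 / CARD('a)) *\<^sub>R Q 1)
          - cscale (trace (((1/2) *\<^sub>R Q 1) ** \<rho>) * (1/2)) ((1 / CARD('a)) *\<^sub>R Q 0)
          + cscale (trace (((1/2) *\<^sub>R Q 1) ** \<rho>) * (1/2)) ((1 / CARD('a)) *\<^sub>R Q 1)"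
        unfolding half tr
        by (simp add: Q_def component_map_def cscale_def vec_eq_iff
            scaleR_conv_of_real[where 'a = complex])
      moreover have "({0, 1} \<times> {0, 1} :: (nat \<times> nat) set) = {(0,0), (0,1), (1,0), (1,1)}"
        by auto
      moreover have "cscale (- c) X = - cscale c X" for c and X :: "'a op"
        by (simp add: cscale_def vec_eq_iff)
      ultimately show "component_map P \<rho> = (\<Sum>(i, j)\<in>{0, 1} \<times> {0, 1}.
          cscale (complex_of_real (if i = j then 1 else -1) *
          trace (((1/2) *\<^sub>R Q i) ** \<rho>) * complex_of_real (1/2)) ((1 / CARD('a)) *\<^sub>R Q j))"
        by simp
    qed simp
  qed
qed

section \<open>Pauli operators: signs as characters, involutions, completeness\<close>

abbreviation overlap_sign :: "nat set \<Rightarrow> nat set \<Rightarrow> complex" where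
  "overlap_sign b s \<equiv> (-1) ^ card (b \<inter> s)"

lemma overlap_sign_prod:
  assumes "finite b"
  shows "overlap_sign b s = (\<Prod>e\<in>b. if e \<in> s then -1 else 1)"
  using prod.inter_restrict[OF assms, of "\<lambda>_. -1" s] by simp

text \<open>An element of \<open>b\<close> common to \<open>s\<close> and \<open>t\<close>
  contributes two factors -1, which cancel. So \<open>overlap_sign b\<close> is a character for
  symmetric difference.\<close>

lemma overlap_sign_sym_diff:
  assumes "finite b"
  shows "overlap_sign b (sym_diff s t) = overlap_sign b s * overlap_sign b t"
  unfolding overlap_sign_prod[OF assms] prod.distrib[symmetric]
  by (rule prod.cong) auto

text \<open>Orthogonality of characters: the sum over subsets factors over \<open>N\<close>, with
  factor 0 for an element of \<open>s\<close> and 2 otherwise.\<close>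

lemma sum_overlap_sign:
  assumes "finite N" "s \<subseteq> N"
  shows "(\<Sum>b\<in>Pow N. overlap_sign b s) = (if s = {} then 2 ^ card N else 0)"
proof -
  have "(\<Sum>b\<in>Pow N. overlap_sign b s) = (\<Sum>b\<in>Pow N. (\<Prod>e\<in>b. if e \<in> s then -1 else 1))"
    using assms by (intro sum.cong overlap_sign_prod) (auto intro: finite_subset)
  also have "\<dots> = (\<Prod>e\<in>N. (if e \<in> s then -1 else 1) + 1)"
    using assms(1) by (subst prod_add) simp_all
  also have "\<dots> = (if s = {} then 2 ^ card N else 0)"
    using assms by (auto intro!: prod_zero)
  finally show ?thesis .
qed

text \<open>\<open>\<phi>\<close> labels the computational basis by bit strings, encoded as finite sets;
  this is \<open>\<i>\<^bsup>|a \<inter> b|\<^esup> X\<^sup>a Z\<^sup>b\<close>, with a phase making it Hermitian.\<close>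

definition pauli :: "('a::finite \<Rightarrow> nat set) \<Rightarrow> nat set \<Rightarrow> nat set \<Rightarrow> 'a op" where
  "pauli \<phi> a b = (\<chi> x y. if sym_diff (\<phi> x) (\<phi> y) = a
     then \<i> ^ card (b \<inter> a) * overlap_sign b (\<phi> y) else 0)"

context
  fixes \<phi> :: "'a::finite \<Rightarrow> nat set" and N :: "nat set"
  assumes N: "finite N" and \<phi>: "bij_betw \<phi> UNIV (Pow N)"
begin

lemma \<phi>_subset: "\<phi> x \<subseteq> N" and \<phi>_eq_iff: "\<phi> x = \<phi> y \<longleftrightarrow> x = y"
  using \<phi> by (auto simp: bij_betw_def inj_eq)

lemma card_eq_power: "CARD('a) = 2 ^ card N"
  using bij_betw_same_card[OF \<phi>] N by (simp add: card_Pow)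

text \<open>Transposing an entry changes the sign by \<open>overlap_sign b a\<close>, which is
  exactly the change of the phase under conjugation.\<close>

lemma hermitian_pauli:
  assumes "b \<subseteq> N"
  shows "hermitian (pauli \<phi> a b)"
proof -
  have "cnj (\<i> ^ card (b \<inter> a) * overlap_sign b (\<phi> x)) = \<i> ^ card (b \<inter> a) * overlap_sign b (\<phi> y)"
    if "sym_diff (\<phi> x) (\<phi> y) = a" for x y
  proof -
    have "\<phi> x = sym_diff (\<phi> y) a" using that by auto
    then have "overlap_sign b (\<phi> x) = overlap_sign b (\<phi> y) * overlap_sign b a"
      using overlap_sign_sym_diff finite_subset[OF assms N] by metis
    moreover have "(- \<i>) ^ k * (-1) ^ k = \<i> ^ k" for k
      by (simp flip: power_mult_distrib)
    ultimately show ?thesis by (simp add: mult.left_commute)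
  qed
  then show ?thesis by (simp add: hermitian_entry pauli_def Un_commute)
qed

text \<open>Only one intermediate label contributes; the two phases give
  \<open>(-1) ^ card (b \<inter> a)\<close>, which the two signs cancel.\<close>

lemma pauli_mult_self:
  assumes "a \<subseteq> N" "b \<subseteq> N"
  shows "pauli \<phi> a b ** pauli \<phi> a b = mat 1"
proof -
  have "(\<Sum>y\<in>UNIV. pauli \<phi> a b $ x $ y * pauli \<phi> a b $ y $ z) = (if x = z then 1 else 0)" for x z
  proof -
    \<comment> \<open>Flipping the bits in \<open>a\<close> must lead to the label of a basis vector
      \<open>w\<close>; surjectivity of \<open>\<phi>\<close> enters here.\<close>
    have "sym_diff (\<phi> z) a \<in> Pow N" using assms \<phi>_subset by blast
    then obtain w where w: "\<phi> w = sym_diff (\<phi> z) a"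
      using \<phi> unfolding bij_betw_def by (metis imageE)
    have wz: "sym_diff (\<phi> y) (\<phi> z) = a \<longleftrightarrow> y = w" for y
      unfolding \<phi>_eq_iff[symmetric] w by auto
    have xw: "sym_diff (\<phi> x) (\<phi> w) = a \<longleftrightarrow> x = z"
      unfolding \<phi>_eq_iff[symmetric] w by auto
    have "(\<Sum>y\<in>UNIV. pauli \<phi> a b $ x $ y * pauli \<phi> a b $ y $ z) =
        (\<Sum>y\<in>UNIV. if y = w then pauli \<phi> a b $ x $ w * pauli \<phi> a b $ w $ z else 0)"
      by (rule sum.cong) (auto simp: pauli_def wz)
    also have "\<dots> = pauli \<phi> a b $ x $ w * pauli \<phi> a b $ w $ z" by simp
    also have "\<dots> = (if x = z then 1 else 0)"
    proof -
      have "overlap_sign b (\<phi> w) = overlap_sign b (\<phi> z) * overlap_sign b a"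
        unfolding w using overlap_sign_sym_diff finite_subset[OF assms(2) N] by blast
      moreover have "(\<i> ^ k * (s * (-1) ^ k)) * (\<i> ^ k * s) = s * s" for k s
      proof -
        have "(\<i> ^ k * (s * (-1) ^ k)) * (\<i> ^ k * s) = s * s * (\<i> * (-1) * \<i>) ^ k"
          by (simp only: power_mult_distrib ac_simps)
        then show ?thesis by simp
      qed
      moreover have "overlap_sign b s * overlap_sign b s = 1" for s
        by (simp flip: power_mult_distrib)
      ultimately show ?thesis
        using wz[of w] xw by (simp only: pauli_def vec_lambda_beta if_True if_False mult_zero_left split: if_split) simp
    qed
    finally show ?thesis .
  qed
  then show ?thesis by (simp add: matrix_matrix_mult_def mat_def vec_eq_iff)
qed

lemma pauli_empty: "pauli \<phi> {} {} = mat 1"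
proof -
  have "sym_diff (\<phi> x) (\<phi> y) = {} \<longleftrightarrow> x = y" for x y
    unfolding \<phi>_eq_iff[symmetric] by auto
  then show ?thesis by (simp add: pauli_def mat_def vec_eq_iff)
qed

text \<open>For \<open>a \<noteq> {}\<close> the diagonal vanishes; for \<open>a = {}\<close> it
  carries a nontrivial character, which sums to 0.\<close>

lemma trace_pauli:
  assumes "b \<subseteq> N" "(a, b) \<noteq> ({}, {})"
  shows "trace (pauli \<phi> a b) = 0"
proof (cases "a = {}")
  case True
  then have "trace (pauli \<phi> a b) = (\<Sum>x\<in>UNIV. overlap_sign b (\<phi> x))"
    by (simp add: trace_def pauli_def)
  also have "\<dots> = (\<Sum>s\<in>Pow N. overlap_sign b s)"
    by (rule sum.reindex_bij_betw[OF \<phi>])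
  \<comment> \<open>\<open>sum_overlap_sign\<close> runs over the other argument; commuting the
    intersection exchanges the roles.\<close>
  also have "\<dots> = 0"
    using sum_overlap_sign[OF N assms(1)] assms(2) True by (simp add: Int_commute)
  finally show ?thesis .
next
  case False
  then show ?thesis by (auto simp: trace_def pauli_def)
qed

text \<open>Only one \<open>a\<close> survives, and the sum over \<open>b\<close> is character
  orthogonality. In tensor terms, the sum of \<open>P \<otimes> P\<close> is the dimension times the
  swap operator.\<close>

lemma sum_pauli_pauli:
  "(\<Sum>(a, b)\<in>Pow N \<times> Pow N. pauli \<phi> a b $ x $ y * pauli \<phi> a b $ z $ w) =
    (if x = w \<and> y = z then 2 ^ card N else 0)"
proof -
  define c where "c = sym_diff (\<phi> x) (\<phi> y)"
  have c: "c \<in> Pow N" using \<phi>_subset unfolding c_def by blast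
  have "(\<Sum>(a, b)\<in>Pow N \<times> Pow N. pauli \<phi> a b $ x $ y * pauli \<phi> a b $ z $ w) =
      (\<Sum>a\<in>Pow N. if c = a then \<Sum>b\<in>Pow N. pauli \<phi> c b $ x $ y * pauli \<phi> c b $ z $ w else 0)"
    unfolding sum.cartesian_product[symmetric]
    by (intro sum.cong refl) (auto simp: pauli_def c_def)
  also have "\<dots> = (\<Sum>b\<in>Pow N. pauli \<phi> c b $ x $ y * pauli \<phi> c b $ z $ w)"
    using c N by simp
  also have "\<dots> = (\<Sum>b\<in>Pow N. if sym_diff (\<phi> z) (\<phi> w) = c
      then overlap_sign b (sym_diff (\<phi> x) (\<phi> w)) else 0)"
  proof (intro sum.cong refl)
    fix b assume "b \<in> Pow N"
    then have b: "finite b" using N finite_subset by blast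
    \<comment> \<open>The two phases multiply to \<open>overlap_sign b c\<close>, so all signs
      combine into that of the label difference of \<open>x\<close> and \<open>w\<close>.\<close>
    have "sym_diff (\<phi> x) (\<phi> w) = sym_diff c (sym_diff (\<phi> y) (\<phi> w))"
      unfolding c_def by blast
    then have "overlap_sign b (sym_diff (\<phi> x) (\<phi> w)) =
        overlap_sign b c * (overlap_sign b (\<phi> y) * overlap_sign b (\<phi> w))"
      using overlap_sign_sym_diff[OF b] by metis
    moreover have "(\<i> ^ k * s) * (\<i> ^ k * t) = (-1) ^ k * (s * t)" for k s t
    proof -
      have "(\<i> ^ k * s) * (\<i> ^ k * t) = (\<i> * \<i>) ^ k * (s * t)"
        by (simp only: power_mult_distrib ac_simps)
      then show ?thesis by simp
    qed
    ultimately show "pauli \<phi> c b $ x $ y * pauli \<phi> c b $ z $ w =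
        (if sym_diff (\<phi> z) (\<phi> w) = c then overlap_sign b (sym_diff (\<phi> x) (\<phi> w)) else 0)"
      by (simp only: pauli_def vec_lambda_beta c_def[symmetric] if_True mult_zero_right split: if_split) simp
  qed
  also have "\<dots> = (if sym_diff (\<phi> z) (\<phi> w) = c \<and> sym_diff (\<phi> x) (\<phi> w) = {} then 2 ^ card N else 0)"
  proof -
    have "sym_diff (\<phi> x) (\<phi> w) \<subseteq> N" using \<phi>_subset by blast
    then show ?thesis
      by (cases "sym_diff (\<phi> z) (\<phi> w) = c") (simp_all only: sum_overlap_sign[OF N] if_True if_False simp_thms sum.neutral_const)
  qed
  also have "sym_diff (\<phi> z) (\<phi> w) = c \<and> sym_diff (\<phi> x) (\<phi> w) = {} \<longleftrightarrow> x = w \<and> y = z"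
    unfolding c_def \<phi>_eq_iff[symmetric] by blast
  finally show ?thesis .
qed

text \<open>Contract \<open>sum_pauli_pauli\<close> with \<open>\<rho>\<close>; its factor
  \<open>2 ^ card N\<close> cancels the normalisation of \<open>component_map\<close>.\<close>

lemma sum_component_map_pauli:
  "(\<Sum>(a, b)\<in>Pow N \<times> Pow N. component_map (pauli \<phi> a b) \<rho>) = \<rho>"
proof -
  have "(\<Sum>(a, b)\<in>Pow N \<times> Pow N. component_map (pauli \<phi> a b) \<rho>) $ x $ y = \<rho> $ x $ y" for x y
  proof -
    have "(\<Sum>(a, b)\<in>Pow N \<times> Pow N. component_map (pauli \<phi> a b) \<rho>) $ x $ y =
        (\<Sum>p\<in>Pow N \<times> Pow N. \<Sum>z\<in>UNIV. \<Sum>w\<in>UNIV. \<rho> $ w $ z / 2 ^ card N *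
          (case p of (a, b) \<Rightarrow> pauli \<phi> a b $ x $ y * pauli \<phi> a b $ z $ w))"
      by (simp add: sum_component case_prod_unfold component_map_def cscale_def card_eq_power trace_def
          matrix_matrix_mult_def sum_distrib_left sum_distrib_right sum_divide_distrib ac_simps)
    also have "\<dots> = (\<Sum>z\<in>UNIV. \<Sum>w\<in>UNIV. \<rho> $ w $ z / 2 ^ card N *
        (\<Sum>(a, b)\<in>Pow N \<times> Pow N. pauli \<phi> a b $ x $ y * pauli \<phi> a b $ z $ w))"
      by (simp only: sum.swap[where A = "Pow N \<times> Pow N"] sum_distrib_left)
    also have "\<dots> = (\<Sum>z\<in>UNIV. \<Sum>w\<in>UNIV. if w = x then if z = y then \<rho> $ x $ y else 0 else 0)"
      unfolding sum_pauli_pauli by (intro sum.cong refl) auto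
    also have "\<dots> = \<rho> $ x $ y" by simp
    finally show ?thesis .
  qed
  then show ?thesis by (simp add: vec_eq_iff)
qed

section \<open>Upper bound from the Pauli expansion, and the exact value\<close>

lemma component_map_pauli_in_MPC_star:
  assumes "a \<subseteq> N" "b \<subseteq> N"
  shows "component_map (pauli \<phi> a b) \<in> MPC_star"
proof (cases "(a, b) = ({}, {})")
  case True
  then show ?thesis by (simp add: pauli_empty component_map_one_in_MPC_star)
next
  case False
  then show ?thesis
    by (intro component_map_involution_in_MPC_star hermitian_pauli pauli_mult_self trace_pauli assms)
qed

text \<open>All Pauli component maps enter with coefficient 1, so the total weight is their
  number.\<close>

lemma qp_extent_id_le: "qp_extent MPC_star (id :: ('a, 'a) opmap) \<le> ereal (4 ^ card N)"
proof -
  define S where "S = Pow N \<times> Pow N"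
  have card: "card S = 4 ^ card N"
    using N by (simp add: S_def card_cartesian_product card_Pow flip: power_mult_distrib)
  obtain h where h: "bij_betw h {0..<card S} S"
    using ex_bij_betw_nat_finite[of S] N by (auto simp: S_def)
  define F where "F i = (case h i of (a, b) \<Rightarrow> component_map (pauli \<phi> a b))" for i
  have "F i \<in> MPC_star" if "i < card S" for i
  proof -
    have "h i \<in> S" using h that by (auto simp: bij_betw_def)
    then show ?thesis by (auto simp: F_def S_def component_map_pauli_in_MPC_star)
  qed
  moreover have "id \<rho> = (\<Sum>i<card S. 1 *\<^sub>R F i \<rho>)" for \<rho>
    using sum_component_map_pauli[of \<rho>] sum.reindex_bij_betw[OF h, of "\<lambda>(a, b). component_map (pauli \<phi> a b) \<rho>"]
    by (simp add: F_def S_def[symmetric] atLeast0LessThan case_prod_unfold)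
  moreover have "card S \<ge> 1" by (simp add: card)
  ultimately have "qp_extent MPC_star (id :: ('a, 'a) opmap) \<le> ereal (\<Sum>i<card S. \<bar>1\<bar>)"
    unfolding qp_extent_def
    by (intro Inf_lower CollectI exI[of _ "card S"] exI[of _ "\<lambda>_. 1"] exI[of _ F]) blast
  then show ?thesis by (simp add: card)
qed

end

theorem theorem5p75:
  fixes n :: nat
  assumes "CARD('d::finite) = 2 ^ n"
  shows "qp_extent (MPC_star :: ('d, 'd) opmap set) (id :: ('d, 'd) opmap) = ereal (4 ^ n)"
proof (rule antisym)
  \<comment> \<open>Equal cardinality supplies a labelling of the basis by bit strings; any such
    bijection serves the Pauli construction.\<close>
  have "card (UNIV :: 'd set) = card (Pow {..<n})"
    using assms by (simp add: card_Pow)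
  then obtain \<phi> :: "'d \<Rightarrow> nat set" where "bij_betw \<phi> UNIV (Pow {..<n})"
    using finite_same_card_bij[of "UNIV :: 'd set" "Pow {..<n}"] by auto
  then show "qp_extent (MPC_star :: ('d, 'd) opmap set) id \<le> ereal (4 ^ n)"
    using qp_extent_id_le[of "{..<n}" \<phi>] by simp
  have "real (CARD('d) ^ 2) = 4 ^ n"
    using assms by (simp add: power2_eq_square flip: power_mult_distrib)
  then show "ereal (4 ^ n) \<le> qp_extent (MPC_star :: ('d, 'd) opmap set) id"
    using qp_extent_id_ge[where 'a = 'd] by simp
qed

end
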